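(* Let $\Bbbk$ be an algebraically closed field of characteristic zero, let $V$ be a $\Bbbk$-vector space of dimension $d$, and let $r$ be an integer with $1<r<\frac{d+1}{2}$. Let $A$ be an $r$-spanning commutative (unital) subalgebra of $\mathrm{End}_{\Bbbk}(V)$. Then: (a) $\dim_{\Bbbk}(A)\le r\cdot(d-r)+1$. (b) If $\dim_{\Bbbk}(A)=r\cdot(d-r)+1$, then $A$ is, up to conjugation (i.e. in a suitable basis of $V$), equal to $\langle \mathrm{Id}\rangle + W_{d-r,r}$.
   Context: A subspace $A\subset \mathrm{End}_{\Bbbk}(V)$ is called commutative if its elements commute pairwise. It is called $r$-spanning if there is a subspace $U\subset V$ of dimension at most $r$ such that $A\cdot U=V$, where $A\cdot U$ is the linear span of $\{a(u): a\in A,u\in U\}$. After fixing a basis of $V$ (so $\mathrm{End}_{\Bbbk}(V)$ is identified with $d\times d$ matrices), $W_{k,l}\subset\mathrm{End}_{\Bbbk}(V)$ denotes the subspace of all matrices whose only nonzero entries lie in the first $k$ rows and the last $l$ columns. *)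

theory Defs
  imports Complex_Main "HOL-Computational_Algebra.Polynomial" "HOL-Library.Function_Algebras"
begin

text \<open>
  The vector space \<open>V\<close> is the universe of a type \<open>'v\<close> with scalar multiplication \<open>scale\<close>.
  Operators on \<open>V\<close> are functions \<open>'v \<Rightarrow> 'v\<close>; \<open>Function_Algebras\<close> supplies their pointwise addition.
  Its pointwise multiplication plays no role here: the product of operators is \<open>(\<circ>)\<close>.
\<close>

definition End_carrier :: "('k::field \<Rightarrow> 'v::ab_group_add \<Rightarrow> 'v) \<Rightarrow> ('v \<Rightarrow> 'v) set" where
  "End_carrier scale = {f. Vector_Spaces.linear scale scale f}"

definition End_scale :: "('k \<Rightarrow> 'v \<Rightarrow> 'v) \<Rightarrow> 'k \<Rightarrow> ('v \<Rightarrow> 'v) \<Rightarrow> ('v \<Rightarrow> 'v)" where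
  "End_scale scale c f = (\<lambda>v. scale c (f v))"

lemma vector_space_End_scale:
  assumes "vector_space scale"
  shows "vector_space (End_scale scale)"
proof -
  interpret vector_space scale by fact
  show ?thesis
    by unfold_locales
      (auto simp: End_scale_def fun_eq_iff scale_right_distrib scale_left_distrib)
qed

definition unital_subalgebra ::
  "('k::field \<Rightarrow> 'v::ab_group_add \<Rightarrow> 'v) \<Rightarrow> ('v \<Rightarrow> 'v) set \<Rightarrow> bool" where
  "unital_subalgebra scale A \<longleftrightarrow>
     A \<subseteq> End_carrier scale \<and> module.subspace (End_scale scale) A \<and>
     id \<in> A \<and> (\<forall>f\<in>A. \<forall>g\<in>A. f \<circ> g \<in> A)"

definition commutative_ops :: "('v \<Rightarrow> 'v) set \<Rightarrow> bool" where
  "commutative_ops A \<longleftrightarrow> (\<forall>f\<in>A. \<forall>g\<in>A. f \<circ> g = g \<circ> f)"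

definition r_spanning ::
  "('k::field \<Rightarrow> 'v::ab_group_add \<Rightarrow> 'v) \<Rightarrow> nat \<Rightarrow> ('v \<Rightarrow> 'v) set \<Rightarrow> bool" where
  "r_spanning scale r A \<longleftrightarrow>
     (\<exists>U. module.subspace scale U \<and> vector_space.dim scale U \<le> r \<and>
          module.span scale {f u | f u. f \<in> A \<and> u \<in> U} = UNIV)"

definition ordered_basis :: "('k::field \<Rightarrow> 'v::ab_group_add \<Rightarrow> 'v) \<Rightarrow> 'v list \<Rightarrow> bool" where
  "ordered_basis scale bs \<longleftrightarrow>
     distinct bs \<and> \<not> module.dependent scale (set bs) \<and> module.span scale (set bs) = UNIV"

text \<open>
  The entry in row \<open>i\<close> and column \<open>j\<close> (both counted from \<open>0\<close>) is the \<open>i\<close>-th coordinate of the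
  image of the \<open>j\<close>-th basis vector.
\<close>

definition matrix_entry ::
  "('k::field \<Rightarrow> 'v::ab_group_add \<Rightarrow> 'v) \<Rightarrow> 'v list \<Rightarrow> ('v \<Rightarrow> 'v) \<Rightarrow> nat \<Rightarrow> nat \<Rightarrow> 'k" where
  "matrix_entry scale bs f i j = module.representation scale (set bs) (f (bs ! j)) (bs ! i)"

text \<open>
  With \<open>d = length bs\<close>, column \<open>j < d\<close> is among the last \<open>l\<close> columns iff \<open>d \<le> j + l\<close>.
\<close>

definition W_space ::
  "('k::field \<Rightarrow> 'v::ab_group_add \<Rightarrow> 'v) \<Rightarrow> 'v list \<Rightarrow> nat \<Rightarrow> nat \<Rightarrow> ('v \<Rightarrow> 'v) set" where
  "W_space scale bs k l =
     {f \<in> End_carrier scale. \<forall>i < length bs. \<forall>j < length bs.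
        matrix_entry scale bs f i j \<noteq> 0 \<longrightarrow> i < k \<and> length bs \<le> j + l}"

end

(*
  Choose U of minimal dimension s <= r with A U = V. For a maximal proper A-invariant subspace M,
  let I be the ideal of those a in A with a V <= M. Over an algebraically closed field I has
  codimension 1 in A, and there are only finitely many such ideals. Minimality of U yields an M
  with U meeting I V trivially, so that V is the direct sum of U and I V. An element of I that
  kills U kills A U = V, hence restriction embeds I into Hom(U, I V), and
  dim A <= s (d - s) + 1 <= r (d - r) + 1, the second step because 2 r <= d. In the case of
  equality s = r and every map from U to I V is the restriction of an element of I; since r >= 2,
  commutativity forces I to kill I V, so I consists of all operators with this block shape.
*)
theory Submission
  imports Defs "HOL-Library.FuncSet"
begin

text \<open>\<open>M\<close> itself is no complement of \<open>U\<close>: \<open>A\<close> acts by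
  scalars on V/M, so \<open>M\<close> is a hyperplane and meets every subspace of dimension at least
  2 nontrivially. The right complement is I V, since V/(I V) is the fibre of the
  \<open>A\<close>-module V at the maximal ideal I. The least dimension of a generating subspace is
  the largest dimension of a fibre, as usual over a semilocal ring, so a minimal \<open>U\<close>
  must map isomorphically onto some fibre. That fibre is found by avoiding one bad vector per ideal
  simultaneously, which takes an infinite field and finitely many ideals. The subspaces
  \<open>M\<close> are no substitute in this count: if \<open>A\<close> consists of the scalars and
  d >= 2, every hyperplane is a maximal invariant subspace, yet all of them give the ideal 0. The
  form in (b) fails for r = 1: a single nilpotent Jordan block of size d >= 3 generates an algebra
  of dimension d = 1 (d - 1) + 1 whose nilpotent elements do not all have square 0. With two
  independent generators, an element of I splits into two summands, each killing a
  generator.\<close>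

section \<open>Spans, block matrices and a numerical inequality\<close>

lemma sum_fun_apply: "(sum g S) x = (\<Sum>s\<in>S. g s x)"
  by (induction S rule: infinite_finite_induct) auto

text \<open>\<open>T\<close> may be dependent: in the equality case it is a spanning set of Hom(U, I
  V) whose size is known only through an upper bound.\<close>

lemma (in vector_space) span_subset_if_card_le:
  assumes "finite T" "independent S" "S \<subseteq> span T" "card T \<le> card S"
  shows "span T \<subseteq> span S"
proof (rule ccontr)
  assume "\<not> span T \<subseteq> span S"
  then obtain t where t: "t \<in> span T" "t \<notin> span S" by blast
  then have "independent (insert t S)"
    using assms(2) independent_insertI by blast
  moreover have "insert t S \<subseteq> span T"
    using t(1) assms(3) by blast
  ultimately have "finite S" "card (insert t S) \<le> card T"
    using independent_span_bound[OF assms(1)] assms(2,3) by blast+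
  moreover have "t \<notin> S" using t(2) span_base by blast
  ultimately show False
    using assms(4) by simp
qed

text \<open>Frees the block shape from coordinates. The first rows are the coordinates along
  \<open>cs\<close>, and the last columns are the images of \<open>bs\<close>.\<close>

lemma (in vector_space) W_space_append:
  assumes D: "independent (set (cs @ bs))" "span (set (cs @ bs)) = UNIV"
    and dist: "distinct (cs @ bs)"
  shows "W_space scale (cs @ bs) (length cs) (length bs) =
    {f \<in> End_carrier scale. (\<forall>b\<in>set bs. f b \<in> span (set cs)) \<and> (\<forall>c\<in>set cs. f c = 0)}"
    (is "?L = ?R")
proof
  define xs where "xs = cs @ bs"
  have rep: "(\<Sum>x\<in>set xs. representation (set xs) v x *s x) = v" for v
    using D by (intro sum_representation_eq) (simp_all add: xs_def)
  have cs: "\<exists>j<length cs. c = xs ! j" if "c \<in> set cs" for c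
    using that by (metis in_set_conv_nth nth_append xs_def)
  have bs: "\<exists>j<length xs. length cs \<le> j \<and> b = xs ! j" if b: "b \<in> set bs" for b
  proof -
    obtain i where "i < length bs" "b = bs ! i"
      using b by (metis in_set_conv_nth)
    then show ?thesis
      by (intro exI[of _ "length cs + i"]) (simp add: xs_def)
  qed
  have len: "length xs \<le> j + length bs \<longleftrightarrow> length cs \<le> j" for j
    by (simp add: xs_def)
  have L: "f \<in> ?L \<longleftrightarrow> f \<in> End_carrier scale \<and> (\<forall>i<length xs. \<forall>j<length xs.
      representation (set xs) (f (xs ! j)) (xs ! i) \<noteq> 0 \<longrightarrow> i < length cs \<and> length cs \<le> j)" for f
    unfolding W_space_def matrix_entry_def xs_def[symmetric] mem_Collect_eq len ..
  show "?L \<subseteq> ?R"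
  proof
    fix f assume "f \<in> ?L"
    note f = this[unfolded L, THEN conjunct1]
      and entry = this[unfolded L, THEN conjunct2, rule_format]
    have "f c = 0" if c: "c \<in> set cs" for c
    proof -
      obtain j where j: "j < length cs" "c = xs ! j"
        using cs[OF c] by blast
      have "representation (set xs) (f c) x = 0" if x: "x \<in> set xs" for x
      proof -
        obtain i where i: "i < length xs" "x = xs ! i"
          using x by (metis in_set_conv_nth)
        have "j < length xs" using j(1) by (simp add: xs_def)
        from entry[OF i(1) this] show ?thesis
          unfolding i(2) j(2) using j(1) by (metis not_le)
      qed
      then show ?thesis
        using rep[of "f c"] by simp
    qed
    moreover have "f b \<in> span (set cs)" if b: "b \<in> set bs" for b
    proof -
      obtain j where j: "j < length xs" "length cs \<le> j" "b = xs ! j"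
        using bs[OF b] by blast
      have "representation (set xs) (f b) x *s x \<in> span (set cs)" if x: "x \<in> set xs" for x
      proof (cases "representation (set xs) (f b) x = 0")
        case True
        then show ?thesis by (simp add: span_zero)
      next
        case False
        obtain i where i: "i < length xs" "x = xs ! i"
          using x by (metis in_set_conv_nth)
        have "i < length cs"
          using entry[OF i(1) j(1)] False unfolding i(2) j(3) by blast
        with i have "x \<in> set cs"
          by (simp add: xs_def nth_append)
        then show ?thesis
          by (intro span_scale span_base)
      qed
      then have "(\<Sum>x\<in>set xs. representation (set xs) (f b) x *s x) \<in> span (set cs)"
        by (rule span_sum)
      then show ?thesis by (simp only: rep)
    qed
    ultimately show "f \<in> ?R"
      using f by simp
  qed
  show "?R \<subseteq> ?L"
  proof
    fix f assume f: "f \<in> ?R"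
    have "i < length cs \<and> length cs \<le> j"
      if ij: "i < length xs" "j < length xs" "representation (set xs) (f (xs ! j)) (xs ! i) \<noteq> 0" for i j
    proof -
      have "xs ! j \<notin> set cs"
      proof
        assume "xs ! j \<in> set cs"
        with f have "f (xs ! j) = 0" by simp
        then have "representation (set xs) (f (xs ! j)) (xs ! i) = 0"
          by (simp only: representation_zero)
        with ij(3) show False by (rule notE)
      qed
      then have j: "length cs \<le> j"
        by (metis not_le nth_append nth_mem xs_def)
      have "xs ! j \<in> set xs"
        using ij(2) by (rule nth_mem)
      with \<open>xs ! j \<notin> set cs\<close> have jb: "xs ! j \<in> set bs"
        by (simp add: xs_def)
      have "f (xs ! j) \<in> span (set cs)"
        using f jb by blast
      \<comment> \<open>A vector of \<open>span (set cs)\<close> has the same coordinates in the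
        smaller basis, and these vanish off \<open>set cs\<close>.\<close>
      then have "representation (set xs) (f (xs ! j)) = representation (set cs) (f (xs ! j))"
        by (rule representation_extend[rotated]) (simp_all add: xs_def D(1)[simplified])
      with ij(3) have "xs ! i \<in> set cs"
        using representation_ne_zero by metis
      moreover have "xs ! i \<in> set bs" if "\<not> i < length cs"
      proof -
        have "xs ! i = bs ! (i - length cs)" "i - length cs < length bs"
          using that ij(1) by (simp_all add: xs_def nth_append)
        then show ?thesis by (metis nth_mem)
      qed
      ultimately show ?thesis
        using dist j by (metis disjoint_iff distinct_append)
    qed
    then have "\<forall>i<length xs. \<forall>j<length xs.
        representation (set xs) (f (xs ! j)) (xs ! i) \<noteq> 0 \<longrightarrow> i < length cs \<and> length cs \<le> j"
      by (intro allI impI)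
    with f show "f \<in> ?L"
      unfolding L by (elim CollectE conjE) (intro conjI)
  qed
qed

text \<open>x (d - x) increases up to d/2. With r = s + t and d = 2 r + m the gap is t (t + m),
  which vanishes only for t = 0.\<close>

lemma mult_diff_le_mult_diff:
  fixes d r s :: nat
  assumes "s \<le> r" "2 * r \<le> d"
  shows "s * (d - s) \<le> r * (d - r)" and "s * (d - s) = r * (d - r) \<Longrightarrow> s = r"
proof -
  obtain t where r: "r = s + t" using assms(1) le_Suc_ex by blast
  obtain m where d: "d = 2 * r + m" using assms(2) le_Suc_ex by blast
  have "d - s = s + 2 * t + m" "d - r = s + t + m"
    using r d by auto
  then have eq: "r * (d - r) = s * (d - s) + t * (t + m)"
    by (simp add: r algebra_simps)
  then show "s * (d - s) \<le> r * (d - r)" by simp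
  show "s = r" if "s * (d - s) = r * (d - r)"
  proof -
    have "t * (t + m) = 0" using eq that by linarith
    then show ?thesis using r by auto
  qed
qed

section \<open>Commuting operators: vector space structure and basic rules\<close>

locale commutative_operator_algebra = finite_dimensional_vector_space scale Basis
  for scale :: "'k::{alg_closed_field, field_char_0} \<Rightarrow> 'v::ab_group_add \<Rightarrow> 'v" (infixr \<open>*s\<close> 75)
    and Basis :: "'v set" +
  fixes A :: "('v \<Rightarrow> 'v) set"
  assumes subalgebra: "unital_subalgebra scale A"
    and commutative: "commutative_ops A"
begin

sublocale E: vector_space "End_scale scale"
  by (rule vector_space_End_scale) unfold_locales

sublocale P: vector_space_pair scale scale
  by unfold_locales

sublocale EE: vector_space_pair "End_scale scale" "End_scale scale"
  by unfold_locales

lemma op_linear: "a \<in> A \<Longrightarrow> Vector_Spaces.linear scale scale a"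
  using subalgebra by (auto simp: unital_subalgebra_def End_carrier_def)

lemma op_add: "a \<in> A \<Longrightarrow> a (x + y) = a x + a y"
  by (simp add: P.linear_add op_linear)

lemma op_diff: "a \<in> A \<Longrightarrow> a (x - y) = a x - a y"
  by (simp add: P.linear_diff op_linear)

lemma op_scale: "a \<in> A \<Longrightarrow> a (c *s x) = c *s a x"
  by (simp add: P.linear_scale op_linear)

lemma op_0: "a \<in> A \<Longrightarrow> a 0 = 0"
  by (simp add: P.linear_0 op_linear)

lemma op_commute: "a \<in> A \<Longrightarrow> b \<in> A \<Longrightarrow> a (b v) = b (a v)"
  using commutative unfolding commutative_ops_def by (metis comp_apply)

lemma subspace_A: "E.subspace A"
  and id_in_A: "id \<in> A"
  and comp_in_A: "a \<in> A \<Longrightarrow> b \<in> A \<Longrightarrow> a \<circ> b \<in> A"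
  using subalgebra by (auto simp: unital_subalgebra_def)

lemma subspace_End_carrier: "E.subspace (End_carrier scale)"
proof -
  have "Vector_Spaces.linear scale scale (0 :: 'v \<Rightarrow> 'v)"
    using P.linear_zero by (simp add: zero_fun_def)
  moreover have "Vector_Spaces.linear scale scale (f + g)"
    if "Vector_Spaces.linear scale scale f" "Vector_Spaces.linear scale scale g" for f g
    using P.linear_compose_add[OF that] by (simp add: plus_fun_def)
  moreover have "Vector_Spaces.linear scale scale (End_scale scale c f)"
    if "Vector_Spaces.linear scale scale f" for f c
    using P.linear_compose_scale_right[OF that] by (simp add: End_scale_def)
  ultimately show ?thesis
    by (auto simp: E.subspace_def End_carrier_def)
qed

subsection \<open>Elementary operators\<close>

text \<open>For \<open>w\<close> in a basis \<open>D\<close> these are the matrix units. Allowing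
  any vector \<open>w\<close> makes the operator linear in \<open>w\<close>, so a spanning set of
  targets yields a spanning set of operators.\<close>

definition elementary :: "'v set \<Rightarrow> 'v \<Rightarrow> 'v \<Rightarrow> 'v \<Rightarrow> 'v" where
  "elementary D b w = P.construct D (\<lambda>x. if x = b then w else 0)"

lemma linear_elementary: "independent D \<Longrightarrow> Vector_Spaces.linear scale scale (elementary D b w)"
  unfolding elementary_def by (rule P.linear_construct)

lemma elementary_basis:
  "independent D \<Longrightarrow> x \<in> D \<Longrightarrow> elementary D b w x = (if x = b then w else 0)"
  unfolding elementary_def by (subst P.construct_basis) auto

lemma elementary_in_span:
  assumes D: "independent D" and w: "w \<in> span C"
  shows "elementary D b w \<in> E.span (elementary D b ` C)"
  using w
proof (induction w rule: span_induct_alt)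
  case base
  have "P.construct D (\<lambda>x. 0 *s 0) v = 0" for v
    using P.construct_scale[OF D, of 0 "\<lambda>x. 0" v] by simp
  then have "elementary D b 0 = 0"
    by (simp add: elementary_def fun_eq_iff)
  then show ?case by (simp only: E.span_zero)
next
  case (step c x y)
  have "elementary D b (c *s x + y) = End_scale scale c (elementary D b x) + elementary D b y"
    unfolding elementary_def End_scale_def plus_fun_def fun_eq_iff
    by (simp flip: P.construct_scale[OF D] P.construct_add[OF D])
      (intro allI arg_cong[where f = "\<lambda>h. P.construct D h _"] ext, auto)
  also have "\<dots> \<in> E.span (elementary D b ` C)"
    using step by (intro E.span_add[OF E.span_scale[OF E.span_base[OF imageI]]])
  finally show ?case .
qed

text \<open>\<open>f\<close> is the sum of \<open>elementary D b (f b)\<close> over \<open>b\<close>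
  in \<open>B\<close>, because both sides agree on \<open>D\<close>.\<close>

lemma in_span_elementary:
  assumes D: "independent D" "span D = UNIV" and BD: "B \<subseteq> D"
    and f: "Vector_Spaces.linear scale scale f"
    and fB: "\<And>b. b \<in> B \<Longrightarrow> f b \<in> span C"
    and f0: "\<And>b. b \<in> D - B \<Longrightarrow> f b = 0"
  shows "f \<in> E.span ((\<lambda>(b, c). elementary D b c) ` (B \<times> C))"
proof -
  have finB: "finite B"
    using D BD finiteI_independent finite_subset by blast
  define g where "g = (\<Sum>b\<in>B. elementary D b (f b))"
  have "g \<in> End_carrier scale"
    unfolding g_def using linear_elementary[OF D(1)]
    by (intro E.subspace_sum subspace_End_carrier) (auto simp: End_carrier_def)
  then have lg: "Vector_Spaces.linear scale scale g"
    by (simp add: End_carrier_def)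
  have "f x = g x" if "x \<in> D" for x
  proof -
    have "g x = (\<Sum>b\<in>B. if x = b then f b else 0)"
      by (simp add: g_def sum_fun_apply elementary_basis[OF D(1) that])
    then show ?thesis
      using finB f0[of x] that by (simp)
  qed
  then have fg: "f = g"
    using P.linear_eq_on[OF f lg, of _ D] D(2) by auto
  have "elementary D b (f b) \<in> E.span ((\<lambda>(b, c). elementary D b c) ` (B \<times> C))"
    if "b \<in> B" for b
    using elementary_in_span[OF D(1) fB[OF that]] that
      E.span_mono[of "elementary D b ` C" "(\<lambda>(b, c). elementary D b c) ` (B \<times> C)"] by auto
  then have "g \<in> E.span ((\<lambda>(b, c). elementary D b c) ` (B \<times> C))"
    unfolding g_def by (rule E.span_sum)
  then show ?thesis
    by (simp only: fg)
qed

text \<open>\<open>E\<close> is the space of all functions on V, in general infinite-dimensional.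
  Every finiteness statement about operators therefore goes through this spanning set.\<close>

lemma End_carrier_finite_span:
  obtains T where "finite T" "End_carrier scale \<subseteq> E.span T"
proof
  show "finite ((\<lambda>(b, c). elementary Basis b c) ` (Basis \<times> Basis))"
    using finite_Basis by simp
  show "End_carrier scale \<subseteq> E.span ((\<lambda>(b, c). elementary Basis b c) ` (Basis \<times> Basis))"
    using in_span_elementary[of Basis Basis _ Basis] independent_Basis span_Basis
    by (auto simp: End_carrier_def)
qed

subsection \<open>Polynomials in an operator\<close>

definition peval :: "('v \<Rightarrow> 'v) \<Rightarrow> 'k poly \<Rightarrow> 'v \<Rightarrow> 'v" where
  "peval a p v = (\<Sum>i\<le>degree p. coeff p i *s (a ^^ i) v)"

lemma peval_altdef:
  assumes "degree p \<le> n"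
  shows "peval a p v = (\<Sum>i\<le>n. coeff p i *s (a ^^ i) v)"
  unfolding peval_def
  by (rule sum.mono_neutral_left) (use assms in \<open>auto simp: coeff_eq_0\<close>)

lemma peval_diff: "peval a (p - q) v = peval a p v - peval a q v"
proof -
  define n where "n = max (degree p) (degree q)"
  have "degree (p - q) \<le> n" "degree p \<le> n" "degree q \<le> n"
    unfolding n_def by (auto intro: degree_diff_le)
  then show ?thesis
    by (simp add: peval_altdef scale_left_diff_distrib sum_subtractf)
qed

lemma peval_smult: "peval a (smult c p) v = c *s peval a p v"
  by (subst peval_altdef[of "smult c p" "degree p"])
    (auto simp: peval_def scale_sum_right)

lemma op_sum: "a \<in> A \<Longrightarrow> a (sum g S) = (\<Sum>s\<in>S. a (g s))"
  by (simp add: P.linear_sum op_linear)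

lemma peval_shift:
  assumes "a \<in> A"
  shows "peval a (pCons 0 p) v = a (peval a p v)"
proof -
  have "peval a (pCons 0 p) v = (\<Sum>i\<le>Suc (degree p). coeff (pCons 0 p) i *s (a ^^ i) v)"
    by (rule peval_altdef) (simp add: degree_pCons_le)
  also have "\<dots> = (\<Sum>i\<le>degree p. coeff p i *s a ((a ^^ i) v))"
    by (subst sum.atMost_Suc_shift) simp
  finally show ?thesis
    using assms by (simp add: peval_def op_sum op_scale)
qed

lemma peval_linear_factor:
  assumes "a \<in> A"
  shows "peval a ([:-l, 1:] * q) v = a (peval a q v) - l *s peval a q v"
proof -
  have "[:-l, 1:] * q = pCons 0 q - smult l q"
    by simp
  then show ?thesis
    by (simp only: peval_diff peval_smult peval_shift[OF assms])
qed

lemma funpow_in_A: "a \<in> A \<Longrightarrow> a ^^ n \<in> A"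
  by (induction n) (auto intro: id_in_A comp_in_A)

text \<open>The first \<open>card T + 1\<close> powers of \<open>a\<close> lie in the span of
  \<open>card T\<close> operators, so they satisfy a linear relation. Dependence is a property of
  sets and overlooks repetitions; equal powers with exponents i and j give the relation X^i - X^j
  instead.\<close>

lemma annihilating_poly:
  assumes a: "a \<in> A"
  obtains p where "p \<noteq> 0" "\<And>v. peval a p v = 0"
proof -
  obtain T where T: "finite T" "End_carrier scale \<subseteq> E.span T"
    by (rule End_carrier_finite_span)
  have pows: "range (\<lambda>i. a ^^ i) \<subseteq> E.span T"
    using T(2) funpow_in_A[OF a] op_linear by (force simp: End_carrier_def)
  define N where "N = card T"
  have "\<exists>c. (\<exists>i\<le>N. c i \<noteq> 0) \<and> (\<Sum>i\<le>N. End_scale scale (c i) (a ^^ i)) = 0"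
  proof (cases "inj_on (\<lambda>i. a ^^ i) {..N}")
    case True
    define S where "S = (\<lambda>i. a ^^ i) ` {..N}"
    have "card S = Suc N"
      using card_image[OF True] by (simp add: S_def)
    then have "\<not> E.independent S"
      using E.independent_span_bound[OF T(1), of S] pows by (auto simp: N_def S_def)
    then obtain u where u: "\<exists>s\<in>S. u s \<noteq> 0" "(\<Sum>s\<in>S. End_scale scale (u s) s) = 0"
      using E.dependent_finite[of S] by (auto simp: S_def)
    then show ?thesis
      using sum.reindex[OF True, of "\<lambda>s. End_scale scale (u s) s"]
      by (intro exI[of _ "\<lambda>i. u (a ^^ i)"]) (auto simp: S_def)
  next
    case False
    then obtain i j where ij: "i \<le> N" "j \<le> N" "i \<noteq> j" "a ^^ i = a ^^ j"
      by (auto simp: inj_on_def)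
    define c where "c = (\<lambda>k. (if k = i then 1 else 0) - (if k = j then 1 else 0 :: 'k))"
    have "(\<Sum>k\<le>N. End_scale scale (c k) (a ^^ k)) =
        (\<Sum>k\<le>N. if k = i then a ^^ k else 0) - (\<Sum>k\<le>N. if k = j then a ^^ k else 0)"
      unfolding sum_subtractf[symmetric]
      by (rule sum.cong) (auto simp: c_def E.scale_left_diff_distrib)
    also have "\<dots> = 0"
      using ij by (simp)
    finally show ?thesis
      using ij by (intro exI[of _ c]) (auto simp: c_def)
  qed
  then obtain c where c: "\<exists>i\<le>N. c i \<noteq> 0" "(\<Sum>i\<le>N. End_scale scale (c i) (a ^^ i)) = 0"
    by blast
  define p where "p = (\<Sum>i\<le>N. monom (c i) i)"
  have coeff_p: "coeff p i = (if i \<le> N then c i else 0)" for i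
    by (simp add: p_def coeff_sum)
  show ?thesis
  proof
    show "p \<noteq> 0"
      using c(1) coeff_p by (metis coeff_0)
    have "degree p \<le> N"
      by (rule degree_le) (simp add: coeff_p)
    then have "peval a p v = (\<Sum>i\<le>N. End_scale scale (c i) (a ^^ i)) v" for v
      by (simp add: peval_altdef coeff_p sum_fun_apply End_scale_def)
    then show "peval a p v = 0" for v
      by (simp add: c(2))
  qed
qed

text \<open>Split off a linear factor, p = (X - l) q. Either q(a) v already lies in \<open>M\<close>
  and q replaces p, or w = q(a) v is the required vector, as a w - l w = p(a) v.\<close>

lemma eigenvector_modulo:
  assumes a: "a \<in> A" and M: "subspace M" and "p \<noteq> 0" "peval a p v \<in> M" "v \<notin> M"
  shows "\<exists>l w. w \<notin> M \<and> a w - l *s w \<in> M"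
  using assms(3-)
proof (induction "degree p" arbitrary: p rule: less_induct)
  case less
  show ?case
  proof (cases "degree p = 0")
    case True
    then obtain c where "p = [:c:]"
      by (rule degree_eq_zeroE)
    with less.prems have "c \<noteq> 0" "c *s v \<in> M"
      by (auto simp: peval_def)
    then have "inverse c *s c *s v \<in> M"
      using M subspace_scale by blast
    with \<open>c \<noteq> 0\<close> less.prems show ?thesis by simp
  next
    case False
    then obtain l where "poly p l = 0"
      using alg_closed_imp_poly_has_root by blast
    then obtain q where q: "p = [:-l, 1:] * q"
      by (auto simp: poly_eq_0_iff_dvd)
    with less.prems have "q \<noteq> 0" by auto
    then have deg: "degree q < degree p"
      unfolding q by (subst degree_mult_eq) auto
    show ?thesis
    proof (cases "peval a q v \<in> M")
      case True
      with less.hyps[OF deg \<open>q \<noteq> 0\<close>] less.prems show ?thesis by blast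
    next
      case False
      with less.prems(2) show ?thesis
        unfolding q peval_linear_factor[OF a] by blast
    qed
  qed
qed

text \<open>On V/M the operator is the scalar \<open>l\<close>, so p(a) is the scalar p(l). For an
  annihilating polynomial this confines \<open>l\<close> to its roots.\<close>

lemma peval_modulo:
  assumes a: "a \<in> A" and M: "subspace M" and eig: "\<And>x. a x - l *s x \<in> M"
  shows "peval a p x - poly p l *s x \<in> M"
proof -
  have pow: "(a ^^ i) x - (l ^ i) *s x \<in> M" for i
  proof (induction i)
    case 0
    show ?case using M by (simp add: subspace_0)
  next
    case (Suc i)
    have "(a ^^ Suc i) x - (l ^ Suc i) *s x =
        (a ((a ^^ i) x) - l *s (a ^^ i) x) + l *s ((a ^^ i) x - (l ^ i) *s x)"
      by (simp add: scale_right_diff_distrib)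
    also have "\<dots> \<in> M"
      using M Suc eig by (intro subspace_add subspace_scale)
    finally show ?case .
  qed
  have "peval a p x - poly p l *s x = (\<Sum>i\<le>degree p. coeff p i *s ((a ^^ i) x - (l ^ i) *s x))"
    by (simp add: peval_def poly_altdef scale_sum_left scale_right_diff_distrib sum_subtractf)
  then show ?thesis
    using M pow by (simp add: subspace_sum subspace_scale)
qed

subsection \<open>Maximal invariant subspaces\<close>

definition invariant :: "'v set \<Rightarrow> bool" where
  "invariant M \<longleftrightarrow> subspace M \<and> (\<forall>a\<in>A. \<forall>v\<in>M. a v \<in> M)"

definition maximal :: "'v set \<Rightarrow> bool" where
  "maximal M \<longleftrightarrow> invariant M \<and> M \<noteq> UNIV \<and>
     (\<forall>N. invariant N \<longrightarrow> M \<subseteq> N \<longrightarrow> N = M \<or> N = UNIV)"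

text \<open>The kernel of the action of \<open>A\<close> on V/M. Like \<open>acts_by\<close>, it is
  phrased by membership in \<open>M\<close> to avoid forming the quotient.\<close>

definition ideal :: "'v set \<Rightarrow> ('v \<Rightarrow> 'v) set" where
  "ideal M = {a \<in> A. range a \<subseteq> M}"

definition acts_by :: "'v set \<Rightarrow> ('v \<Rightarrow> 'v) \<Rightarrow> 'k \<Rightarrow> bool" where
  "acts_by M a l \<longleftrightarrow> (\<forall>x. a x - l *s x \<in> M)"

definition cyclic_span :: "'v set \<Rightarrow> 'v set" where
  "cyclic_span U = span {f u | f u. f \<in> A \<and> u \<in> U}"

text \<open>The product J V. For J = \<open>ideal M\<close> it is contained in \<open>M\<close>,
  possibly properly.\<close>

definition image_span :: "('v \<Rightarrow> 'v) set \<Rightarrow> 'v set" where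
  "image_span J = span (\<Union>f\<in>J. range f)"

lemma maximal_subspace: "maximal M \<Longrightarrow> subspace M"
  by (simp add: maximal_def invariant_def)

text \<open>Dimensions are bounded, so a proper invariant subspace above \<open>N\<close> of
  greatest dimension will do.\<close>

lemma exists_maximal:
  assumes "invariant N" "N \<noteq> UNIV"
  obtains M where "maximal M" "N \<subseteq> M"
proof -
  define Q where "Q = (\<lambda>M. invariant M \<and> M \<noteq> UNIV \<and> N \<subseteq> M)"
  have "Q N" using assms by (simp add: Q_def)
  moreover have "\<forall>M. Q M \<longrightarrow> dim M < Suc dimension"
    using dim_subset_UNIV by (simp add: less_Suc_eq_le)
  ultimately obtain M where M: "Q M" "\<And>M'. Q M' \<Longrightarrow> dim M' \<le> dim M"
    using ex_has_greatest_nat[of Q N dim "Suc dimension"] by blast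
  have "N' = M \<or> N' = UNIV" if N': "invariant N'" "M \<subseteq> N'" for N'
  proof (cases "N' = UNIV")
    case False
    with N' M(1) have "Q N'" by (auto simp: Q_def)
    with M(2) have "dim N' \<le> dim M" by blast
    then show ?thesis
      using subspace_dim_equal[of M N'] N' M(1) by (auto simp: Q_def invariant_def)
  qed simp
  with M(1) that show ?thesis by (auto simp: maximal_def Q_def)
qed

lemma invariant_cyclic_span: "invariant (cyclic_span U)"
  unfolding invariant_def
proof (intro conjI ballI)
  show "subspace (cyclic_span U)"
    by (simp add: cyclic_span_def)
  fix a v assume a: "a \<in> A" and v: "v \<in> cyclic_span U"
  show "a v \<in> cyclic_span U"
    using v unfolding cyclic_span_def
  proof (induction v rule: span_induct_alt)
    case base
    show ?case by (simp add: op_0[OF a] span_zero)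
  next
    case (step c x y)
    then obtain f u where x: "x = f u" "f \<in> A" "u \<in> U" by blast
    then have "a x \<in> span {f u | f u. f \<in> A \<and> u \<in> U}"
      using comp_in_A[OF a] by (intro span_base) (metis (mono_tags, lifting) comp_apply mem_Collect_eq)
    with step show ?case
      by (simp add: op_add[OF a] op_scale[OF a] span_add span_scale)
  qed
qed

lemma cyclic_span_superset: "U \<subseteq> cyclic_span U"
proof
  fix u assume "u \<in> U"
  with id_in_A have "id u \<in> {f u | f u. f \<in> A \<and> u \<in> U}" by blast
  then show "u \<in> cyclic_span U"
    by (simp add: cyclic_span_def span_base)
qed

lemma cyclic_span_subset:
  assumes "invariant M" "U \<subseteq> M"
  shows "cyclic_span U \<subseteq> M"
proof -
  have "f u \<in> M" if "f \<in> A" "u \<in> U" for f u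
    using assms that by (simp add: invariant_def subset_iff)
  then have "{f u | f u. f \<in> A \<and> u \<in> U} \<subseteq> M"
    by (intro subsetI) (elim CollectE exE conjE, simp)
  then show ?thesis
    unfolding cyclic_span_def using assms(1) by (intro span_minimal) (simp_all add: invariant_def)
qed

text \<open>Schur's lemma for V/M: \<open>N\<close> is the preimage of an eigenspace of
  \<open>a\<close> on the quotient. It is invariant by commutativity and strictly larger than
  \<open>M\<close>, hence everything.\<close>

lemma acts_by_exists:
  assumes M: "maximal M" and a: "a \<in> A"
  shows "\<exists>l. acts_by M a l"
proof -
  have sM: "subspace M" and inv: "invariant M"
    using M by (auto simp: maximal_def invariant_def)
  obtain v where v: "v \<notin> M"
    using M by (auto simp: maximal_def)
  obtain p where "p \<noteq> 0" "peval a p v = 0"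
    using annihilating_poly[OF a] by metis
  then obtain l w where lw: "w \<notin> M" "a w - l *s w \<in> M"
    using eigenvector_modulo[OF a sM _ _ v, of p] sM by (auto simp: subspace_0)
  define N where "N = {x. a x - l *s x \<in> M}"
  have "x + y \<in> N" if "x \<in> N" "y \<in> N" for x y
  proof -
    have "a (x + y) - l *s (x + y) = (a x - l *s x) + (a y - l *s y)"
      by (simp add: op_add[OF a] scale_right_distrib)
    with that sM show ?thesis by (simp add: N_def subspace_add)
  qed
  moreover have "c *s x \<in> N" if "x \<in> N" for c x
  proof -
    have "a (c *s x) - l *s (c *s x) = c *s (a x - l *s x)"
      by (simp add: op_scale[OF a] scale_right_diff_distrib mult.commute)
    with that sM show ?thesis
      unfolding N_def mem_Collect_eq by (metis subspace_scale)
  qed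
  moreover have "0 \<in> N"
    using sM by (simp add: N_def op_0[OF a] subspace_0)
  moreover have "b x \<in> N" if "b \<in> A" "x \<in> N" for b x
  proof -
    have "a (b x) - l *s b x = b (a x - l *s x)"
      using that a by (simp add: op_diff op_scale op_commute)
    with that inv show ?thesis by (simp add: N_def invariant_def)
  qed
  ultimately have "invariant N"
    by (simp add: invariant_def subspace_def)
  moreover have "M \<subseteq> N"
    using inv a sM by (auto simp: N_def invariant_def subspace_diff subspace_scale)
  moreover have "w \<in> N" using lw by (simp add: N_def)
  ultimately have "N = UNIV"
    using M lw(1) by (auto simp: maximal_def)
  then show ?thesis by (auto simp: N_def acts_by_def)
qed

lemma ideal_iff_acts_by:
  assumes M: "maximal M" and a: "a \<in> A" and l: "acts_by M a l"
  shows "a \<in> ideal M \<longleftrightarrow> l = 0"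
proof
  assume "a \<in> ideal M"
  then have *: "a x \<in> M" for x by (auto simp: ideal_def)
  have sM: "subspace M" using M by (rule maximal_subspace)
  show "l = 0"
  proof (rule ccontr)
    assume "l \<noteq> 0"
    have "x \<in> M" for x
    proof -
      have "a x - (a x - l *s x) \<in> M"
        by (rule subspace_diff[OF sM]) (use * l in \<open>auto simp: acts_by_def\<close>)
      moreover have "a x - (a x - l *s x) = l *s x"
        by simp
      ultimately have "l *s x \<in> M" by (simp only:)
      then have "inverse l *s (l *s x) \<in> M"
        by (rule subspace_scale[OF sM])
      with \<open>l \<noteq> 0\<close> show ?thesis by simp
    qed
    with M show False by (auto simp: maximal_def)
  qed
next
  assume "l = 0"
  with l a show "a \<in> ideal M" by (auto simp: ideal_def acts_by_def)
qed

lemma acts_by_combination: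
  assumes "subspace M" "acts_by M a k" "acts_by M b l"
  shows "acts_by M (End_scale scale c a + b) (c * k + l)"
proof -
  have "(End_scale scale c a + b) x - (c * k + l) *s x = c *s (a x - k *s x) + (b x - l *s x)" for x
    by (simp add: End_scale_def scale_right_diff_distrib scale_left_distrib)
  with assms show ?thesis
    unfolding acts_by_def by (metis subspace_add subspace_scale)
qed

text \<open>The scalar by which an operator acts is linear in the operator, so agreement on a
  spanning set is agreement on \<open>A\<close>; the ideal is the set where this scalar is
  0.\<close>

lemma ideal_eqI:
  assumes M: "maximal M" and N: "maximal N" and X: "X \<subseteq> A" "A \<subseteq> E.span X"
    and eq: "\<And>a. a \<in> X \<Longrightarrow> \<exists>l. acts_by M a l \<and> acts_by N a l"
  shows "ideal M = ideal N"
proof -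
  note sub = maximal_subspace[OF M] maximal_subspace[OF N]
  have "\<exists>l. acts_by M a l \<and> acts_by N a l" if "a \<in> E.span X" for a
    using that
  proof (induction a rule: E.span_induct_alt)
    case base
    show ?case using sub by (intro exI[of _ 0]) (auto simp: acts_by_def subspace_0)
  next
    case (step c x y)
    with eq[of x] acts_by_combination sub show ?case by blast
  qed
  then have "a \<in> ideal M \<longleftrightarrow> a \<in> ideal N" if "a \<in> A" for a
    using ideal_iff_acts_by[OF M that] ideal_iff_acts_by[OF N that] X that by blast
  then show ?thesis by (auto simp: ideal_def)
qed

lemma finite_independent_subset_A:
  assumes "X \<subseteq> A" "E.independent X"
  shows "finite X"
proof -
  obtain T where T: "finite T" "End_carrier scale \<subseteq> E.span T"
    by (rule End_carrier_finite_span)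
  have "X \<subseteq> E.span T"
    using assms(1) T(2) op_linear by (force simp: End_carrier_def)
  then show ?thesis
    using E.independent_span_bound[OF T(1) assms(2)] by simp
qed

text \<open>The scalars by which a finite basis \<open>X\<close> of \<open>A\<close> acts on V/M
  determine the ideal, and each is a root of a polynomial that does not depend on
  \<open>M\<close>.\<close>

lemma finite_ideals: "finite (ideal ` Collect maximal)"
proof -
  obtain X where "X \<subseteq> A" "E.independent X" "A \<subseteq> E.span X"
    by (rule E.basis_exists)
  then have X: "X \<subseteq> A" "A \<subseteq> E.span X" "finite X"
    using finite_independent_subset_A by auto
  have "\<exists>p. p \<noteq> 0 \<and> (\<forall>v. peval a p v = 0)" if a: "a \<in> A" for a
  proof -
    obtain p where "p \<noteq> 0" "\<And>v. peval a p v = 0"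
      using annihilating_poly[OF a] by metis
    then show ?thesis by blast
  qed
  then obtain p where p: "\<And>a. a \<in> A \<Longrightarrow> p a \<noteq> 0" "\<And>a v. a \<in> A \<Longrightarrow> peval a (p a) v = 0"
    by metis
  define ev where "ev = (\<lambda>M a. SOME l. acts_by M a l)"
  have ev: "acts_by M a (ev M a)" if "maximal M" "a \<in> A" for M a
    unfolding ev_def using acts_by_exists[OF that] by (rule someI_ex)
  define F where "F = (\<lambda>M. restrict (ev M) X)"
  have root: "poly (p a) (ev M a) = 0" if M: "maximal M" and a: "a \<in> A" for M a
  proof -
    have sM: "subspace M" using M by (rule maximal_subspace)
    \<comment> \<open>Since p(a) = 0, the zero operator acts by p(l). It belongs to the ideal, which
      forces p(l) = 0.\<close>
    have "acts_by M 0 (poly (p a) (ev M a))"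
      unfolding acts_by_def
      using peval_modulo[OF a sM, of "ev M a" "p a"] ev[OF M a] p(2)[OF a]
      by (simp add: acts_by_def)
    moreover have "0 \<in> ideal M"
      using subspace_A sM by (auto simp: ideal_def E.subspace_0 subspace_0)
    ultimately show ?thesis
      using ideal_iff_acts_by[OF M, of 0] E.subspace_0[OF subspace_A] by blast
  qed
  have "F ` Collect maximal \<subseteq> PiE X (\<lambda>a. {l. poly (p a) l = 0})"
    using root X(1) by (auto simp: F_def restrict_PiE_iff)
  moreover have "finite (PiE X (\<lambda>a. {l. poly (p a) l = 0}))"
    using X p(1) by (intro finite_PiE poly_roots_finite) auto
  ultimately have fin: "finite (F ` Collect maximal)"
    by (rule finite_subset)
  have eq: "ideal M = ideal N" if MN: "maximal M" "maximal N" "F M = F N" for M N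
  proof (rule ideal_eqI[OF MN(1,2) X(1,2)])
    fix a assume a: "a \<in> X"
    then have "ev M a = ev N a"
      using MN(3) unfolding F_def by (metis restrict_apply')
    with a X ev MN show "\<exists>l. acts_by M a l \<and> acts_by N a l"
      by (metis subsetD)
  qed
  \<comment> \<open>\<open>F M\<close> determines the ideal but not \<open>M\<close>, so one
    representative is chosen for each value of \<open>F\<close>.\<close>
  have "ideal ` Collect maximal \<subseteq>
      (\<lambda>h. ideal (SOME M. maximal M \<and> F M = h)) ` F ` Collect maximal"
    (is "_ \<subseteq> ?G ` _")
  proof (rule image_subsetI)
    fix M assume "M \<in> Collect maximal"
    then have M: "maximal M" by simp
    define M' where "M' = (SOME N. maximal N \<and> F N = F M)"
    have "maximal M' \<and> F M' = F M"
      unfolding M'_def using M by (intro someI[of "\<lambda>N. maximal N \<and> F N = F M" M]) simp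
    then have "ideal M = ?G (F M)"
      using eq[OF M, of M'] unfolding M'_def by metis
    then show "ideal M \<in> ?G ` F ` Collect maximal"
      using M by (intro image_eqI[of _ ?G "F M"] imageI CollectI)
  qed
  then show ?thesis
    by (rule finite_subset) (intro finite_imageI fin)
qed

section \<open>Generators that complement I V\<close>

text \<open>Coordinates of \<open>v\<close> become the coefficients of a polynomial
  \<open>q v\<close>; evaluation at a fixed t is linear in \<open>v\<close>. Each nonzero vector
  excludes only finitely many t, and the field is infinite.\<close>

lemma separating_functional:
  assumes "finite K" "0 \<notin> K"
  shows "\<exists>\<phi>. Vector_Spaces.linear scale (*) \<phi> \<and> (\<forall>k\<in>K. \<phi> k \<noteq> 0)"
proof -
  obtain bs where bs: "set bs = Basis" "distinct bs"
    using finite_distinct_list[OF finite_Basis] by blast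
  define q where "q = (\<lambda>v. \<Sum>i<length bs. monom (representation Basis v (bs ! i)) i)"
  have q: "q v \<noteq> 0" if "v \<noteq> 0" for v
  proof
    assume "q v = 0"
    have "representation Basis v b = 0" for b
    proof (cases "b \<in> Basis")
      case True
      then obtain i where i: "i < length bs" "b = bs ! i"
        using bs by (metis in_set_conv_nth)
      then have "coeff (q v) i = representation Basis v b"
        by (simp add: q_def coeff_sum)
      with \<open>q v = 0\<close> show ?thesis by simp
    qed (use representation_ne_zero in blast)
    then have "v = 0"
      using sum_nonzero_representation_eq[OF independent_Basis, of v] span_Basis by simp
    with that show False ..
  qed
  with assms(2) have "q k \<noteq> 0" if "k \<in> K" for k
    using that by metis
  then have "finite (\<Union>k\<in>K. {t. poly (q k) t = 0})"
    using assms(1) by (intro finite_UN_I poly_roots_finite)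
  then obtain t where t: "t \<notin> (\<Union>k\<in>K. {t. poly (q k) t = 0})"
    using ex_new_if_finite infinite_UNIV_char_0 by blast
  have "vector_space ((*) :: 'k \<Rightarrow> 'k \<Rightarrow> 'k)"
    by unfold_locales (simp_all add: algebra_simps)
  then have "Vector_Spaces.linear scale (*) (\<lambda>v. poly (q v) t)"
    unfolding Vector_Spaces.linear_iff
    using independent_Basis span_Basis vector_space_axioms
    by (auto simp: q_def poly_sum poly_monom representation_add representation_scale
        distrib_right sum.distrib sum_distrib_left mult.assoc)
  with t show ?thesis by (intro exI[of _ "\<lambda>v. poly (q v) t"]) auto
qed

lemma image_span_ideal_subset: "maximal M \<Longrightarrow> image_span (ideal M) \<subseteq> M"
  unfolding image_span_def
  by (rule span_minimal[OF _ maximal_subspace]) (simp_all add: ideal_def UN_subset_iff)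

text \<open>
  Otherwise some hyperplane of \<open>U\<close> avoids one nonzero vector of \<open>U \<inter> image_span (ideal M)\<close> for each
  of the finitely many ideals; a maximal \<open>M\<close> containing that hyperplane would also contain the
  avoided vector, hence \<open>U\<close>. So the hyperplane still generates \<open>V\<close>, against minimality.
\<close>
lemma minimal_generators_meet_trivially:
  assumes U: "subspace U" "cyclic_span U = UNIV"
    and min: "\<And>H. subspace H \<Longrightarrow> cyclic_span H = UNIV \<Longrightarrow> dim U \<le> dim H"
    and nontrivial: "(UNIV :: 'v set) \<noteq> {0}"
  shows "\<exists>M. maximal M \<and> U \<inter> image_span (ideal M) = {0}"
proof (rule ccontr)
  assume neg: "\<not> (\<exists>M. maximal M \<and> U \<inter> image_span (ideal M) = {0})"
  \<comment> \<open>Indexed by the ideal rather than by \<open>M\<close>, so that only finitely many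
    vectors have to be avoided.\<close>
  define k where "k = (\<lambda>J. SOME x. x \<in> U \<and> x \<in> image_span J \<and> x \<noteq> 0)"
  have k: "k (ideal M) \<in> U \<and> k (ideal M) \<in> image_span (ideal M) \<and> k (ideal M) \<noteq> 0"
    if "maximal M" for M
  proof -
    have "0 \<in> U \<inter> image_span (ideal M)"
      using U(1) by (simp add: subspace_0 image_span_def span_zero)
    with neg that have "\<exists>x. x \<in> U \<and> x \<in> image_span (ideal M) \<and> x \<noteq> 0" by blast
    then show ?thesis unfolding k_def by (rule someI_ex)
  qed
  have "finite (k ` ideal ` Collect maximal)"
    by (intro finite_imageI finite_ideals)
  moreover have "0 \<notin> k ` ideal ` Collect maximal"
    using k by force
  ultimately have "\<exists>\<phi>. Vector_Spaces.linear scale (*) \<phi> \<and>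
      (\<forall>x\<in>k ` ideal ` Collect maximal. \<phi> x \<noteq> 0)"
    by (rule separating_functional)
  then obtain \<phi> where lin: "Vector_Spaces.linear scale (*) \<phi>"
    and \<phi>_image: "\<forall>x\<in>k ` ideal ` Collect maximal. \<phi> x \<noteq> 0"
    by (elim exE conjE)
  have \<phi>: "\<phi> (k (ideal M)) \<noteq> 0" if "maximal M" for M
    using \<phi>_image that by blast
  interpret \<phi>: Vector_Spaces.linear scale "(*)" \<phi> by (rule lin)
  define H where "H = {u \<in> U. \<phi> u = 0}"
  have sH: "subspace H"
    using U(1) by (auto simp: H_def subspace_def \<phi>.add \<phi>.scale)
  \<comment> \<open>\<open>H\<close> is proper only if there is at least one vector to avoid; V
    being nonzero supplies a maximal subspace.\<close>
  have "invariant {0}"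
    by (auto simp: invariant_def op_0)
  then obtain M0 where "maximal M0"
    using exists_maximal[of "{0}"] nontrivial by metis
  then have "H \<noteq> U"
    using k \<phi> by (auto simp: H_def)
  then have "\<not> dim U \<le> dim H"
    using subspace_dim_equal[OF sH U(1)] by (auto simp: H_def)
  then have "cyclic_span H \<noteq> UNIV"
    using min sH by blast
  then obtain M where M: "maximal M" "cyclic_span H \<subseteq> M"
    using exists_maximal[OF invariant_cyclic_span] by metis
  define w where "w = k (ideal M)"
  have w: "w \<in> U" "w \<in> M" "\<phi> w \<noteq> 0"
    using k[OF M(1)] \<phi>[OF M(1)] image_span_ideal_subset[OF M(1)] by (auto simp: w_def)
  have "u \<in> M" if "u \<in> U" for u
  proof -
    \<comment> \<open>The multiple of \<open>w\<close> that brings \<open>u\<close> into the kernel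
      of the functional.\<close>
    define c where "c = \<phi> u / \<phi> w"
    have "u - c *s w \<in> H"
      using that w U(1) by (simp add: H_def subspace_diff subspace_scale \<phi>.diff \<phi>.scale c_def)
    then have "u - c *s w \<in> M"
      using cyclic_span_superset M(2) by blast
    then have "(u - c *s w) + c *s w \<in> M"
      using w maximal_subspace[OF M(1)] by (intro subspace_add subspace_scale)
    then show ?thesis by simp
  qed
  then have "cyclic_span U \<subseteq> M"
    using M(1) by (intro cyclic_span_subset) (auto simp: maximal_def)
  with U(2) M(1) show False by (auto simp: maximal_def)
qed

section \<open>Splitting the scalars off A\<close>

lemma subspace_ideal:
  assumes "maximal M"
  shows "E.subspace (ideal M)"
proof -
  have ideal: "a \<in> ideal M \<longleftrightarrow> a \<in> A \<and> (\<forall>x. a x \<in> M)" for a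
    by (auto simp: ideal_def)
  have sM: "subspace M" using assms by (rule maximal_subspace)
  show ?thesis
  proof (rule E.subspaceI)
    show "0 \<in> ideal M"
      by (simp add: ideal E.subspace_0[OF subspace_A] subspace_0[OF sM])
    show "f + g \<in> ideal M" if "f \<in> ideal M" "g \<in> ideal M" for f g
      using that by (simp add: ideal E.subspace_add[OF subspace_A] subspace_add[OF sM])
    show "End_scale scale c f \<in> ideal M" if "f \<in> ideal M" for c f
      using that E.subspace_scale[OF subspace_A, of f c] subspace_scale[OF sM]
      by (simp add: ideal) (simp add: End_scale_def)
  qed
qed

lemma ideal_decomposition:
  assumes M: "maximal M" and a: "a \<in> A"
  obtains l f where "f \<in> ideal M" "a = End_scale scale l id + f"
proof -
  obtain l where l: "acts_by M a l"
    using acts_by_exists[OF M a] by blast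
  have "a - End_scale scale l id \<in> A"
    using a id_in_A subspace_A by (simp add: E.subspace_diff E.subspace_scale)
  with l have "a - End_scale scale l id \<in> ideal M"
    by (auto simp: ideal_def acts_by_def End_scale_def)
  moreover have "a = End_scale scale l id + (a - End_scale scale l id)" by simp
  ultimately show ?thesis by (rule that)
qed

text \<open>An operator of \<open>A\<close> is l Id + g with g in the ideal, so it sends u to l u +
  g u, the first term in \<open>U\<close> and the second in I V.\<close>

lemma generators_plus_image_span:
  assumes M: "maximal M" and U: "subspace U" "cyclic_span U = UNIV"
  obtains u w where "u \<in> U" "w \<in> image_span (ideal M)" "v = u + w"
proof -
  have "{f u | f u. f \<in> A \<and> u \<in> U} \<subseteq> {x + y | x y. x \<in> U \<and> y \<in> image_span (ideal M)}"
  proof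
    fix x assume "x \<in> {f u | f u. f \<in> A \<and> u \<in> U}"
    then obtain f u where x: "x = f u" and f: "f \<in> A" and u: "u \<in> U"
      by (elim CollectE exE conjE)
    obtain l g where g: "g \<in> ideal M" "f = End_scale scale l id + g"
      by (rule ideal_decomposition[OF M f])
    have "f u = l *s u + g u"
      by (simp add: g(2) End_scale_def)
    moreover have "l *s u \<in> U"
      by (rule subspace_scale[OF U(1) u])
    moreover have "g u \<in> image_span (ideal M)"
      unfolding image_span_def using g(1) by (intro span_base) blast
    ultimately show "x \<in> {x + y | x y. x \<in> U \<and> y \<in> image_span (ideal M)}"
      unfolding x by (intro CollectI exI conjI)
  qed
  then have "cyclic_span U \<subseteq> {x + y | x y. x \<in> U \<and> y \<in> image_span (ideal M)}"
    unfolding cyclic_span_def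
    by (rule span_minimal) (intro subspace_sums U(1), simp add: image_span_def)
  with U(2) have "v \<in> {x + y | x y. x \<in> U \<and> y \<in> image_span (ideal M)}" by (simp only: subset_iff UNIV_I)
  then show ?thesis using that by (elim CollectE exE conjE)
qed

lemma ideal_iff: "f \<in> ideal M \<longleftrightarrow> f \<in> A \<and> (\<forall>x. f x \<in> M)"
  by (auto simp: ideal_def)

text \<open>Adjoining \<open>id\<close> to a basis of the ideal gives a basis of \<open>A\<close>;
  \<open>id\<close> lies outside the ideal because \<open>M\<close> is proper.\<close>

lemma dim_eq_Suc_dim_ideal:
  assumes M: "maximal M"
  shows "E.dim A = Suc (E.dim (ideal M))"
proof -
  obtain X where X: "X \<subseteq> ideal M" "E.independent X" "ideal M \<subseteq> E.span X" "card X = E.dim (ideal M)"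
    by (rule E.basis_exists)
  have XA: "X \<subseteq> A" using X(1) by (auto simp: ideal_def)
  have "id \<notin> ideal M"
    using M by (auto simp: ideal_iff maximal_def)
  moreover have "E.span X \<subseteq> ideal M"
    by (rule E.span_minimal[OF X(1) subspace_ideal[OF M]])
  ultimately have id: "id \<notin> E.span X" by blast
  show ?thesis
  proof (rule E.dim_unique)
    show "insert id X \<subseteq> A"
      using XA id_in_A by simp
    show "E.independent (insert id X)"
      using id X(2) by (rule E.independent_insertI)
    show "A \<subseteq> E.span (insert id X)"
    proof
      fix a assume "a \<in> A"
      then obtain l f where "f \<in> ideal M" "a = End_scale scale l id + f"
        by (rule ideal_decomposition[OF M])
      moreover have "E.span X \<subseteq> E.span (insert id X)"
        by (rule E.span_mono) auto
      ultimately show "a \<in> E.span (insert id X)"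
        using X(3) by (auto intro!: E.span_add E.span_scale intro: E.span_base)
    qed
    show "card (insert id X) = Suc (E.dim (ideal M))"
      using card_insert_disjoint[OF finite_independent_subset_A[OF XA X(2)], of id]
        E.span_base[of id X] id X(4) by metis
  qed
qed

section \<open>The direct sum of U and I V, and the restriction of I to U\<close>

context
  fixes M U B C :: "'v set"
  assumes M: "maximal M"
    and U: "subspace U" "cyclic_span U = UNIV"
    and trivial_meet: "U \<inter> image_span (ideal M) = {0}"
    and B: "B \<subseteq> U" "independent B" "U \<subseteq> span B"
    and C: "C \<subseteq> image_span (ideal M)" "independent C" "image_span (ideal M) \<subseteq> span C"
begin

lemma span_B: "span B = U"
  using span_subspace B U(1) by blast

lemma span_C: "span C = image_span (ideal M)"
  using span_subspace[OF C(1) C(3)] by (simp add: image_span_def)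

lemma finite_BC: "finite B" "finite C"
  using B(2) C(2) finiteI_independent by auto

lemma disjoint_BC: "B \<inter> C = {}"
proof -
  have "B \<inter> C \<subseteq> {0}"
    using trivial_meet B(1) C(1) by blast
  moreover have "0 \<notin> B"
    using B(2) dependent_zero by blast
  ultimately show ?thesis by blast
qed

lemma independent_BC: "independent (B \<union> C)"
proof (rule independent_if_scalars_zero)
  show "finite (B \<union> C)" using finite_BC by simp
  fix f x assume sum: "(\<Sum>x\<in>B \<union> C. f x *s x) = 0" and x: "x \<in> B \<union> C"
  have eq: "(\<Sum>x\<in>B. f x *s x) + (\<Sum>x\<in>C. f x *s x) = 0"
    using sum sum.union_disjoint[OF finite_BC disjoint_BC, of "\<lambda>x. f x *s x"] by simp
  have b: "(\<Sum>x\<in>B. f x *s x) \<in> span B" and c: "(\<Sum>x\<in>C. f x *s x) \<in> span C"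
    by (auto intro!: span_sum span_scale intro: span_base)
  have "(\<Sum>x\<in>B. f x *s x) = - (\<Sum>x\<in>C. f x *s x)"
    using eq by (simp add: eq_neg_iff_add_eq_0)
  with b c have "(\<Sum>x\<in>B. f x *s x) \<in> span B \<inter> span C"
    using span_neg by (metis IntI)
  then have "(\<Sum>x\<in>B. f x *s x) = 0"
    using trivial_meet by (simp add: span_B span_C)
  moreover from this have "(\<Sum>x\<in>C. f x *s x) = 0"
    using eq by simp
  ultimately show "f x = 0"
    using x independentD[OF B(2) finite_BC(1) subset_refl, of f x]
      independentD[OF C(2) finite_BC(2) subset_refl, of f x] by blast
qed

lemma span_BC: "span (B \<union> C) = UNIV"
proof (rule UNIV_eq_I[symmetric])
  fix v
  obtain u w where uw: "u \<in> U" "w \<in> image_span (ideal M)" "v = u + w"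
    by (rule generators_plus_image_span[OF M U])
  have "u \<in> span (B \<union> C)"
    using uw(1) span_mono[of B "B \<union> C"] span_B by blast
  moreover have "w \<in> span (B \<union> C)"
    using uw(2) span_mono[of C "B \<union> C"] span_C by blast
  ultimately show "v \<in> span (B \<union> C)"
    unfolding uw(3) by (rule span_add)
qed

lemma card_BC: "card B + card C = dim UNIV"
  using dim_eq_card[of "B \<union> C" UNIV] independent_BC span_BC
    card_Un_disjoint[OF finite_BC disjoint_BC] by simp

text \<open>Projects onto \<open>U\<close> along I V. Composing with it encodes restriction to
  \<open>U\<close> as an operator on V, so that Hom(U, I V) can be treated inside
  \<open>E\<close>.\<close>

definition projection :: "'v \<Rightarrow> 'v" where
  "projection = P.construct (B \<union> C) (\<lambda>x. if x \<in> B then x else 0)"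

lemma linear_projection: "Vector_Spaces.linear scale scale projection"
  unfolding projection_def by (rule P.linear_construct[OF independent_BC])

lemma projection_B: "b \<in> B \<Longrightarrow> projection b = b"
  unfolding projection_def by (subst P.construct_basis[OF independent_BC]) auto

lemma projection_C: "c \<in> C \<Longrightarrow> projection c = 0"
  unfolding projection_def using disjoint_BC
  by (subst P.construct_basis[OF independent_BC]) auto

definition elementary_operators :: "('v \<Rightarrow> 'v) set" where
  "elementary_operators = (\<lambda>(b, c). elementary (B \<union> C) b c) ` (B \<times> C)"

lemma finite_elementary_operators: "finite elementary_operators"
  using finite_BC by (simp add: elementary_operators_def)

lemma card_elementary_operators: "card elementary_operators \<le> card B * card C"
  unfolding elementary_operators_def
  using card_image_le[of "B \<times> C"] finite_BC by (simp add: card_cartesian_product)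

lemma span_elementary_operatorsI:
  assumes "Vector_Spaces.linear scale scale f"
    and "\<And>b. b \<in> B \<Longrightarrow> f b \<in> image_span (ideal M)" and "\<And>c. c \<in> C \<Longrightarrow> f c = 0"
  shows "f \<in> E.span elementary_operators"
  unfolding elementary_operators_def
  by (rule in_span_elementary[OF independent_BC span_BC]) (use assms span_C in auto)

lemma ideal_in_image_span: "f \<in> ideal M \<Longrightarrow> f x \<in> image_span (ideal M)"
  unfolding image_span_def by (rule span_base) blast

lemma ideal_comp_projection: "f \<in> ideal M \<Longrightarrow> f \<circ> projection \<in> E.span elementary_operators"
proof (rule span_elementary_operatorsI)
  assume f: "f \<in> ideal M"
  then have "f \<in> A" by (simp add: ideal_iff)
  then show "Vector_Spaces.linear scale scale (f \<circ> projection)"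
    using Vector_Spaces.linear_compose linear_projection op_linear by blast
  show "(f \<circ> projection) b \<in> image_span (ideal M)" for b
    using ideal_in_image_span[OF f] by simp
  show "(f \<circ> projection) c = 0" if "c \<in> C" for c
    using that op_0[OF \<open>f \<in> A\<close>] by (simp add: projection_C)
qed

text \<open>By commutativity the kernel of \<open>f\<close> is invariant, so it contains everything
  that \<open>U\<close> generates.\<close>

lemma ideal_eq_0I:
  assumes f: "f \<in> ideal M" and fB: "\<And>b. b \<in> B \<Longrightarrow> f b = 0"
  shows "f = 0"
proof -
  have fA: "f \<in> A" using f by (simp add: ideal_iff)
  have "a x \<in> {x. f x = 0}" if "a \<in> A" "x \<in> {x. f x = 0}" for a x
    using that op_commute[OF fA, of a x] op_0[of a] by simp
  then have inv: "invariant {x. f x = 0}"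
    by (auto simp: invariant_def subspace_def op_0[OF fA] op_add[OF fA] op_scale[OF fA])
  have "U \<subseteq> {x. f x = 0}"
    unfolding span_B[symmetric]
    by (rule span_minimal) (use fB inv in \<open>auto simp: invariant_def\<close>)
  then have "cyclic_span U \<subseteq> {x. f x = 0}"
    by (rule cyclic_span_subset[OF inv])
  then show ?thesis
    unfolding U(2) by (auto simp: fun_eq_iff)
qed

lemma linear_comp_projection:
  "Vector_Spaces.linear (End_scale scale) (End_scale scale) (\<lambda>f. f \<circ> projection)"
  unfolding Vector_Spaces.linear_iff
  using E.vector_space_axioms by (simp add: End_scale_def fun_eq_iff)

lemma inj_on_comp_projection: "inj_on (\<lambda>f. f \<circ> projection) (ideal M)"
proof (rule inj_onI)
  fix f g assume fg: "f \<in> ideal M" "g \<in> ideal M" "f \<circ> projection = g \<circ> projection"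
  have "f - g = 0"
  proof (rule ideal_eq_0I)
    show "f - g \<in> ideal M"
      by (rule E.subspace_diff[OF subspace_ideal[OF M] fg(1,2)])
    show "(f - g) b = 0" if "b \<in> B" for b
      using fun_cong[OF fg(3), of b] projection_B[OF that] by simp
  qed
  then show "f = g" by simp
qed

text \<open>Comparing these independent restrictions with \<open>elementary_operators\<close> gives
  both the dimension bound and, when the counts agree, surjectivity.\<close>

lemma ideal_basis_comp_projection:
  obtains X where "X \<subseteq> ideal M" "E.span X = ideal M"
    "E.independent ((\<lambda>f. f \<circ> projection) ` X)"
    "(\<lambda>f. f \<circ> projection) ` X \<subseteq> E.span elementary_operators"
    "card ((\<lambda>f. f \<circ> projection) ` X) = E.dim (ideal M)"
proof -
  obtain X where X: "X \<subseteq> ideal M" "E.independent X" "ideal M \<subseteq> E.span X" "card X = E.dim (ideal M)"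
    by (rule E.basis_exists)
  have span: "E.span X = ideal M"
    by (rule E.span_subspace[OF X(1,3) subspace_ideal[OF M]])
  show ?thesis
  proof (rule that[OF X(1) span])
    show "E.independent ((\<lambda>f. f \<circ> projection) ` X)"
      using linear_comp_projection X(2) inj_on_comp_projection
      by (intro EE.linear_independent_injective_image) (simp_all add: span)
    show "(\<lambda>f. f \<circ> projection) ` X \<subseteq> E.span elementary_operators"
      using X(1) ideal_comp_projection by blast
    show "card ((\<lambda>f. f \<circ> projection) ` X) = E.dim (ideal M)"
      using card_image[OF inj_on_subset[OF inj_on_comp_projection X(1)]] X(4) by simp
  qed
qed

lemma dim_ideal_le: "E.dim (ideal M) \<le> card B * card C"
proof -
  obtain X where "E.independent ((\<lambda>f. f \<circ> projection) ` X)"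
    "(\<lambda>f. f \<circ> projection) ` X \<subseteq> E.span elementary_operators"
    "card ((\<lambda>f. f \<circ> projection) ` X) = E.dim (ideal M)"
    by (rule ideal_basis_comp_projection)
  then show ?thesis
    using E.independent_span_bound[OF finite_elementary_operators] card_elementary_operators
    by (metis le_trans)
qed

section \<open>Equality: every map from U to I V is a restriction\<close>

context
  assumes full: "E.dim (ideal M) = card B * card C"
begin

text \<open>At full dimension the restrictions of a basis of the ideal are at least as numerous as
  the elementary operators, so they span them. The prescribed values, extended by 0 on
  \<open>C\<close>, then form such a restriction.\<close>

lemma ideal_interpolation:
  assumes h: "\<And>b. b \<in> B \<Longrightarrow> h b \<in> image_span (ideal M)"
  shows "\<exists>f\<in>ideal M. \<forall>b\<in>B. f b = h b"
proof -
  define g where "g = P.construct (B \<union> C) (\<lambda>x. if x \<in> B then h x else 0)"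
  have g: "g x = (if x \<in> B then h x else 0)" if "x \<in> B \<union> C" for x
    unfolding g_def by (rule P.construct_basis[OF independent_BC that])
  have "g \<in> E.span elementary_operators"
  proof (rule span_elementary_operatorsI)
    show "Vector_Spaces.linear scale scale g"
      unfolding g_def by (rule P.linear_construct[OF independent_BC])
    show "g b \<in> image_span (ideal M)" if "b \<in> B" for b
      using g[of b] h that by simp
    show "g c = 0" if "c \<in> C" for c
      using g[of c] that disjoint_BC by auto
  qed
  moreover obtain X where X: "X \<subseteq> ideal M" "E.span X = ideal M"
    "E.independent ((\<lambda>f. f \<circ> projection) ` X)"
    "(\<lambda>f. f \<circ> projection) ` X \<subseteq> E.span elementary_operators"
    "card ((\<lambda>f. f \<circ> projection) ` X) = E.dim (ideal M)"
    by (rule ideal_basis_comp_projection)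
  have "E.span elementary_operators \<subseteq> E.span ((\<lambda>f. f \<circ> projection) ` X)"
    using finite_elementary_operators X(3,4)
    by (rule E.span_subset_if_card_le) (simp add: X(5) full card_elementary_operators)
  ultimately have "g \<in> (\<lambda>f. f \<circ> projection) ` ideal M"
    using EE.linear_span_image[OF linear_comp_projection, of X] X(2) by blast
  then obtain f where f: "f \<in> ideal M" "g = f \<circ> projection"
    by blast
  have "f b = h b" if "b \<in> B" for b
    using g[of b] that by (simp add: f(2) projection_B)
  with f(1) show ?thesis by blast
qed

lemma ideal_kills_if_kills_basis_vector:
  assumes a: "a \<in> ideal M" and b: "b \<in> B" "a b = 0" and w: "w \<in> image_span (ideal M)"
  shows "a w = 0"
proof -
  txt \<open>If \<open>e\<close> in the ideal sends \<open>b\<close> to \<open>w\<close>, then \<open>a w = a (e b) = e (a b) = 0\<close>.\<close>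
  have "(if x = b then w else 0) \<in> image_span (ideal M)" for x
    using w by (simp add: image_span_def span_zero)
  from ideal_interpolation[of "\<lambda>x. if x = b then w else 0", OF this]
  obtain e where e: "e \<in> ideal M" "\<And>x. x \<in> B \<Longrightarrow> e x = (if x = b then w else 0)"
    by metis
  have "a w = a (e b)" using e(2)[OF b(1)] by simp
  also have "\<dots> = e (a b)"
    using a e(1) by (intro op_commute) (simp_all add: ideal_iff)
  also have "\<dots> = 0"
    using b(2) e(1) op_0 by (simp add: ideal_iff)
  finally show ?thesis .
qed

lemma ideal_kills_image_span:
  assumes card: "2 \<le> card B" and a: "a \<in> ideal M" and w: "w \<in> image_span (ideal M)"
  shows "a w = 0"
proof -
  txt \<open>Each of the summands \<open>a1\<close> and \<open>a - a1\<close> of \<open>a\<close> kills a vector of \<open>B\<close>.\<close>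
  obtain b b' where b: "b \<in> B" "b' \<in> B" "b \<noteq> b'"
    using card by (metis card_2_iff' obtain_subset_with_card_n subsetD)
  have "(if x = b' then a b' else 0) \<in> image_span (ideal M)" for x
    using ideal_in_image_span[OF a] by (simp add: image_span_def span_zero)
  from ideal_interpolation[of "\<lambda>x. if x = b' then a b' else 0", OF this]
  obtain a1 where a1: "a1 \<in> ideal M" "\<And>x. x \<in> B \<Longrightarrow> a1 x = (if x = b' then a b' else 0)"
    by metis
  have "a1 w = 0"
    by (rule ideal_kills_if_kills_basis_vector[OF a1(1) b(1) _ w]) (use a1(2) b in simp)
  moreover have "a - a1 \<in> ideal M"
    by (rule E.subspace_diff[OF subspace_ideal[OF M] a a1(1)])
  then have "(a - a1) w = 0"
    by (rule ideal_kills_if_kills_basis_vector[OF _ b(2) _ w]) (use a1(2) b in simp)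
  ultimately show ?thesis by simp
qed

text \<open>Interpolation gives an element of the ideal that agrees with a block operator on
  \<open>B\<close>; on \<open>C\<close> both vanish.\<close>

lemma ideal_eq_block_operators:
  assumes card: "2 \<le> card B"
  shows "ideal M = {f \<in> End_carrier scale. (\<forall>b\<in>B. f b \<in> span C) \<and> (\<forall>c\<in>C. f c = 0)}"
    (is "_ = ?W")
proof
  have kills: "f c = 0" if "f \<in> ideal M" "c \<in> C" for f c
    using ideal_kills_image_span[OF card that(1)] C(1) that(2) by blast
  show "ideal M \<subseteq> ?W"
    using kills ideal_in_image_span op_linear by (auto simp: span_C End_carrier_def ideal_iff)
  show "?W \<subseteq> ideal M"
  proof
    fix f assume f: "f \<in> ?W"
    then obtain g where g: "g \<in> ideal M" "\<And>b. b \<in> B \<Longrightarrow> g b = f b"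
      using ideal_interpolation[of f] span_C by blast
    have "f x = g x" for x
    proof (rule P.linear_eq_on[where f = f and g = g and x = x and B = "B \<union> C"])
      show "Vector_Spaces.linear scale scale f" "Vector_Spaces.linear scale scale g"
        using f g(1) op_linear by (auto simp: End_carrier_def ideal_iff)
      show "x \<in> span (B \<union> C)" by (simp add: span_BC)
      show "f b = g b" if "b \<in> B \<union> C" for b
        using that g kills f by auto
    qed
    then have "f = g" by (rule ext)
    with g(1) show "f \<in> ideal M" by simp
  qed
qed

end

end

section \<open>Minimal generators and the final count\<close>

lemma minimal_cyclic_generators:
  assumes "subspace U" "cyclic_span U = UNIV"
  obtains U' where "subspace U'" "cyclic_span U' = UNIV" "dim U' \<le> dim U"
    "\<And>H. subspace H \<Longrightarrow> cyclic_span H = UNIV \<Longrightarrow> dim U' \<le> dim H"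
proof -
  define Q where "Q = (\<lambda>H. subspace H \<and> cyclic_span H = UNIV)"
  have "Q U" using assms by (simp add: Q_def)
  then obtain U' where U': "Q U'" "\<And>H. Q H \<Longrightarrow> dim U' \<le> dim H"
    using ex_has_least_nat[of Q U dim] by blast
  with \<open>Q U\<close> that[of U'] show ?thesis
    by (simp add: Q_def)
qed

lemma dim_and_extremal_form:
  assumes d: "dim UNIV = d" and r: "1 < r" "2 * r \<le> d" and span: "r_spanning scale r A"
  shows "E.dim A \<le> r * (d - r) + 1"
    and "E.dim A = r * (d - r) + 1 \<Longrightarrow> \<exists>bs. ordered_basis scale bs \<and>
      A = {f + g | f g. f \<in> E.span {id} \<and> g \<in> W_space scale bs (d - r) r}"
proof -
  obtain U0 where U0: "subspace U0" "dim U0 \<le> r" "cyclic_span U0 = UNIV"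
    using span by (auto simp: r_spanning_def cyclic_span_def)
  obtain U where U: "subspace U" "cyclic_span U = UNIV" "dim U \<le> dim U0"
    and min: "\<And>H. subspace H \<Longrightarrow> cyclic_span H = UNIV \<Longrightarrow> dim U \<le> dim H"
    using minimal_cyclic_generators[OF U0(1,3)] by blast
  have "(UNIV :: 'v set) \<noteq> {0}"
  proof
    assume "(UNIV :: 'v set) = {0}"
    then have "dim (UNIV :: 'v set) = 0" by (simp del: dim_UNIV)
    with d r show False by simp
  qed
  with min have "\<exists>M. maximal M \<and> U \<inter> image_span (ideal M) = {0}"
    by (rule minimal_generators_meet_trivially[OF U(1,2)])
  then obtain M where M: "maximal M" "U \<inter> image_span (ideal M) = {0}"
    by (elim exE conjE)
  obtain B where B: "B \<subseteq> U" "independent B" "U \<subseteq> span B" "card B = dim U"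
    by (rule basis_exists)
  obtain C where C: "C \<subseteq> image_span (ideal M)" "independent C" "image_span (ideal M) \<subseteq> span C"
    by (rule basis_exists)
  note setting = M(1) U(1,2) M(2) B(1-3) C
  define s where "s = card B"
  have s: "s \<le> r" using B(4) U(3) U0(2) by (simp add: s_def)
  have card_C: "card C = d - s"
    using card_BC[OF setting] d by (simp add: s_def)
  have dim_A: "E.dim A = Suc (E.dim (ideal M))"
    by (rule dim_eq_Suc_dim_ideal[OF M(1)])
  have le: "E.dim (ideal M) \<le> s * (d - s)"
    using dim_ideal_le[OF setting] by (simp add: card_C s_def)
  with dim_A mult_diff_le_mult_diff(1)[OF s r(2)] show "E.dim A \<le> r * (d - r) + 1"
    by simp
  assume "E.dim A = r * (d - r) + 1"
  with dim_A have ideal_dim: "E.dim (ideal M) = r * (d - r)" by simp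
  with le mult_diff_le_mult_diff(1)[OF s r(2)] have "s * (d - s) = r * (d - r)" by simp
  with mult_diff_le_mult_diff(2)[OF s r(2)] have "s = r" by blast
  with card_C have cards: "card B = r" "card C = d - r"
    by (simp_all add: s_def)
  have ideal_eq: "ideal M = {f \<in> End_carrier scale. (\<forall>b\<in>B. f b \<in> span C) \<and> (\<forall>c\<in>C. f c = 0)}"
    by (rule ideal_eq_block_operators[OF setting]) (use ideal_dim cards r in simp_all)
  obtain bl cl where lists: "set bl = B" "distinct bl" "set cl = C" "distinct cl"
    using finite_distinct_list finite_BC[OF setting] by metis
  have len: "length bl = r" "length cl = d - r"
    using lists cards distinct_card by metis+
  \<comment> \<open>The basis of I V comes first: its d - r vectors index the admissible rows, and
    the r vectors of \<open>bl\<close> the admissible columns.\<close>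
  have D: "independent (set (cl @ bl))" "span (set (cl @ bl)) = UNIV" "distinct (cl @ bl)"
    using independent_BC[OF setting] span_BC[OF setting] disjoint_BC[OF setting] lists
    by (auto simp: Un_commute)
  have W: "W_space scale (cl @ bl) (d - r) r = ideal M"
    using W_space_append[OF D] by (simp add: len lists ideal_eq)
  have "A = {f + g | f g. f \<in> E.span {id} \<and> g \<in> ideal M}"
  proof (intro subset_antisym subsetI)
    fix a assume "a \<in> A"
    then obtain l g where "g \<in> ideal M" "a = End_scale scale l id + g"
      by (rule ideal_decomposition[OF M(1)])
    then show "a \<in> {f + g | f g. f \<in> E.span {id} \<and> g \<in> ideal M}"
      by (auto intro: E.span_scale E.span_base)
  next
    fix a assume "a \<in> {f + g | f g. f \<in> E.span {id} \<and> g \<in> ideal M}"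
    then obtain f g where fg: "a = f + g" "f \<in> E.span {id}" "g \<in> ideal M" by blast
    have "E.span {id} \<subseteq> A"
      by (rule E.span_minimal[OF _ subspace_A]) (simp add: id_in_A)
    with fg show "a \<in> A"
      using E.subspace_add[OF subspace_A] by (auto simp: ideal_iff)
  qed
  then show "\<exists>bs. ordered_basis scale bs \<and>
      A = {f + g | f g. f \<in> E.span {id} \<and> g \<in> W_space scale bs (d - r) r}"
    using D by (intro exI[of _ "cl @ bl"]) (simp add: ordered_basis_def W)
qed

end

theorem theorem4p6:
  fixes scale :: "'k::{alg_closed_field, field_char_0} \<Rightarrow> 'v::ab_group_add \<Rightarrow> 'v"
    and Basis :: "'v set"
    and A :: "('v \<Rightarrow> 'v) set"
    and d r :: nat
  assumes "finite_dimensional_vector_space scale Basis"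
    and "vector_space.dim scale UNIV = d"
    and "1 < r" and "real r < (real d + 1) / 2"
    and "unital_subalgebra scale A"
    and "commutative_ops A"
    and "r_spanning scale r A"
  shows "vector_space.dim (End_scale scale) A \<le> r * (d - r) + 1 \<and>
    (vector_space.dim (End_scale scale) A = r * (d - r) + 1 \<longrightarrow>
      (\<exists>bs. ordered_basis scale bs \<and>
        A = {f + g | f g. f \<in> module.span (End_scale scale) {id} \<and>
                          g \<in> W_space scale bs (d - r) r}))"
proof -
  interpret finite_dimensional_vector_space scale Basis by fact
  interpret commutative_operator_algebra scale Basis A
    by unfold_locales (use assms in simp_all)
  \<comment> \<open>For integers, 2 r < d + 1 is the same as 2 r <= d.\<close>
  have "2 * r \<le> d"
    using assms(4) by simp
  then show ?thesis
    using dim_and_extremal_form[OF assms(2,3) _ assms(7)] by blast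
qed

end
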